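(* Any given presentation $P=\langle g_1,\dots,g_n;r_1,\dots,r_m\rangle$ can be transformed to an equivalent presentation $P'$ whose unary size is $O(b(P)\log n)$, where $b(P)$ is the binary size of $P$.
   Context: A (finite) presentation $P=\langle g_1,\dots,g_n;r_1,\dots,r_m\rangle$ has generators $g_i$ and relations $r_j$, which are words in the $g_i$ and their inverses; the group $G(P)$ is the quotient of the free group on the generators by the smallest normal subgroup containing the elements represented by the $r_j$. Two presentations are equivalent if they present isomorphic groups. It is assumed that a given presentation always has at least as many relations as generators (free groups can be presented with $n$ copies of the symbol denoting the empty word as relations). Unary size: if each relation $r_j$ is written as a word $g'_1\cdots g'_{k_j}$ of length $k_j$ in generators and inverses of generators, the unary size of the presentation is $n+\sum_{j=1}^m k_j$, where $n$ is the number of generators. (An additional multiplicative factor for addressing the generators, needed to encode a presentation, is suppressed.) Binary size: for a generator $g$, let $m_g$ be the largest exponent of $g$ or of its inverse $g^{-1}$ appearing in the words $r_j$ (and for $g'=g^{-1}$ let $m_{g'}=m_g$). Write $r_j={g'_1}^{k_{j1}}\cdots{g'_{m_j}}^{k_{jm_j}}$, where the $g'_l$ are generators or inverses of generators and $g'_l\neq g'_{l+1}$. The binary size of the word $r_j$ is $b(r_j)=\sum_{l=1}^{m_j}\lceil\log_2 m_{g'_l}\rceil$, and the binary size of the presentation is $b(P)=n+\sum_{j=1}^m b(r_j)$.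
   Formalization: In the binary size each syllable costs max(1, ⌈log₂ m_g⌉) instead of ⌈log₂ m_g⌉, since otherwise ⟨a,b; (ab)^k, 1⟩ has binary size 2 for all k and the claim fails; log n is read as max(1, log₂ n), which matters only for n ≤ 1. *)

theory Defs
  imports Complex_Main "HOL-Algebra.Coset"
begin

section \<open>Words and free groups\<close>

text \<open>The generators are \<open>0, \<dots>, n - 1\<close>; the letter \<open>(i, True)\<close> stands for
  the generator \<open>i\<close> and \<open>(i, False)\<close> for its inverse.  Words need not be freely reduced.\<close>

type_synonym letter = "nat \<times> bool"
type_synonym word = "letter list"

definition inv_letter :: "letter \<Rightarrow> letter" where
  "inv_letter x = (fst x, \<not> snd x)"

definition words :: "nat \<Rightarrow> word set" where
  "words n = lists ({..<n} \<times> UNIV)"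

inductive_set free_rel :: "nat \<Rightarrow> (word \<times> word) set" for n :: nat where
  cancel: "u \<in> words n \<Longrightarrow> v \<in> words n \<Longrightarrow> [x] \<in> words n \<Longrightarrow>
             (u @ [x, inv_letter x] @ v, u @ v) \<in> free_rel n"
| refl: "u \<in> words n \<Longrightarrow> (u, u) \<in> free_rel n"
| sym: "(u, v) \<in> free_rel n \<Longrightarrow> (v, u) \<in> free_rel n"
| trans: "(u, v) \<in> free_rel n \<Longrightarrow> (v, w) \<in> free_rel n \<Longrightarrow> (u, w) \<in> free_rel n"

definition free_group :: "nat \<Rightarrow> word set monoid" where
  "free_group n =
     \<lparr>carrier = words n // free_rel n,
      mult = (\<lambda>A B. \<Union>u\<in>A. \<Union>v\<in>B. free_rel n `` {u @ v}),
      one = free_rel n `` {[]}\<rparr>"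

lemma inv_letter_inv_letter [simp]: "inv_letter (inv_letter x) = x"
  by (simp add: inv_letter_def)

lemma words_append [simp]: "u @ v \<in> words n \<longleftrightarrow> u \<in> words n \<and> v \<in> words n"
  by (auto simp: words_def)

lemma words_Nil [simp]: "[] \<in> words n"
  by (simp add: words_def)

lemma words_Cons: "x # v \<in> words n \<longleftrightarrow> [x] \<in> words n \<and> v \<in> words n"
  by (auto simp: words_def)

lemma inv_letter_words [simp]: "[inv_letter x] \<in> words n \<longleftrightarrow> [x] \<in> words n"
  by (auto simp: words_def inv_letter_def mem_Times_iff)

lemma free_rel_words: "(u, v) \<in> free_rel n \<Longrightarrow> u \<in> words n \<and> v \<in> words n"
proof (induction rule: free_rel.induct)
  case (cancel u v x)
  then show ?case
    using words_Cons[of x "inv_letter x # v" n] words_Cons[of "inv_letter x" v n] by simp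
qed auto

lemma equiv_free_rel: "equiv (words n) (free_rel n)"
proof (rule equivI)
  show "free_rel n \<subseteq> words n \<times> words n"
    using free_rel_words by auto
  show "refl_on (words n) (free_rel n)"
    by (simp add: refl_on_def free_rel.refl)
  show "sym (free_rel n)"
    by (rule symI) (rule free_rel.sym)
  show "trans (free_rel n)"
    by (rule transI) (rule free_rel.trans)
qed

lemma free_rel_context:
  "(u, v) \<in> free_rel n \<Longrightarrow> a \<in> words n \<Longrightarrow> b \<in> words n \<Longrightarrow> (a @ u @ b, a @ v @ b) \<in> free_rel n"
proof (induction rule: free_rel.induct)
  case (cancel u v x)
  then show ?case
    using free_rel.cancel[of "a @ u" n "v @ b" x] by simp
next
  case (refl u)
  then show ?case by (simp add: free_rel.refl)
next
  case (sym u v)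
  then show ?case by (simp add: free_rel.sym)
next
  case (trans u v w)
  then show ?case by (meson free_rel.trans)
qed

lemma free_rel_append:
  assumes "(u, u') \<in> free_rel n" "(v, v') \<in> free_rel n"
  shows "(u @ v, u' @ v') \<in> free_rel n"
proof (rule free_rel.trans)
  show "(u @ v, u' @ v) \<in> free_rel n"
    using free_rel_context[OF assms(1), of "[]" v] free_rel_words[OF assms(2)] by simp
  show "(u' @ v, u' @ v') \<in> free_rel n"
    using free_rel_context[OF assms(2), of u' "[]"] free_rel_words[OF assms(1)] by simp
qed

lemma free_group_mult:
  assumes "u \<in> words n" "v \<in> words n"
  shows "(free_rel n `` {u}) \<otimes>\<^bsub>free_group n\<^esub> (free_rel n `` {v}) = free_rel n `` {u @ v}"
proof -
  have "free_rel n `` {u' @ v'} = free_rel n `` {u @ v}"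
    if "(u, u') \<in> free_rel n" "(v, v') \<in> free_rel n" for u' v'
    using equiv_class_eq[OF equiv_free_rel free_rel_append[OF that]] by (rule HOL.sym)
  then have "(\<Union>u'\<in>free_rel n `` {u}. \<Union>v'\<in>free_rel n `` {v}. free_rel n `` {u' @ v'})
      = (\<Union>u'\<in>free_rel n `` {u}. \<Union>v'\<in>free_rel n `` {v}. free_rel n `` {u @ v})"
    by (intro SUP_cong HOL.refl) blast
  moreover have "u \<in> free_rel n `` {u}" "v \<in> free_rel n `` {v}"
    using assms by (simp_all add: free_rel.refl)
  ultimately show ?thesis
    unfolding free_group_def by auto
qed

lemma free_group_inverse:
  "u \<in> words n \<Longrightarrow> \<exists>v\<in>words n. (v @ u, []) \<in> free_rel n"
proof (induction u)
  case Nil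
  show ?case by (rule bexI[of _ "[]"]) (simp_all add: free_rel.refl)
next
  case (Cons x u)
  have x: "[x] \<in> words n" and u: "u \<in> words n"
    using Cons.prems words_Cons[of x u n] by simp_all
  obtain v where v: "v \<in> words n" "(v @ u, []) \<in> free_rel n"
    using Cons.IH[OF u] by blast
  have "(v @ [inv_letter x, inv_letter (inv_letter x)] @ u, v @ u) \<in> free_rel n"
    using v u x by (intro free_rel.cancel) auto
  then have "((v @ [inv_letter x]) @ x # u, []) \<in> free_rel n"
    using free_rel.trans[OF _ v(2)] by simp
  moreover have "v @ [inv_letter x] \<in> words n"
    using v(1) x by simp
  ultimately show ?case by blast
qed

lemma group_free_group: "group (free_group n)"
proof -
  have carrier: "carrier (free_group n) = (\<lambda>u. free_rel n `` {u}) ` words n"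
    by (auto simp: free_group_def quotient_def)
  have one: "\<one>\<^bsub>free_group n\<^esub> = free_rel n `` {[]}"
    by (simp add: free_group_def)
  show ?thesis
  proof (rule groupI)
    fix A assume "A \<in> carrier (free_group n)"
    then obtain u where u: "u \<in> words n" "A = free_rel n `` {u}"
      by (auto simp: carrier)
    then obtain v where v: "v \<in> words n" "(v @ u, []) \<in> free_rel n"
      using free_group_inverse by blast
    then have "free_rel n `` {v} \<otimes>\<^bsub>free_group n\<^esub> A = \<one>\<^bsub>free_group n\<^esub>"
      using u equiv_class_eq[OF equiv_free_rel v(2)] by (simp add: free_group_mult one)
    then show "\<exists>B\<in>carrier (free_group n). B \<otimes>\<^bsub>free_group n\<^esub> A = \<one>\<^bsub>free_group n\<^esub>"
      using v(1) by (auto simp: carrier)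
  qed (auto simp: carrier one free_group_mult)
qed


section \<open>Presentations\<close>

record presentation =
  ngens :: nat
  rels :: "word list"

text \<open>Presentations have at least as many relations as generators; empty words may be used as
  padding.\<close>

definition is_presentation :: "presentation \<Rightarrow> bool" where
  "is_presentation P \<longleftrightarrow> set (rels P) \<subseteq> words (ngens P) \<and> ngens P \<le> length (rels P)"

definition normal_closure :: "('a, 'b) monoid_scheme \<Rightarrow> 'a set \<Rightarrow> 'a set" where
  "normal_closure G S = \<Inter>{N. N \<lhd> G \<and> S \<subseteq> N}"

lemma (in group) normal_closure_normal:
  assumes "S \<subseteq> carrier G"
  shows "normal_closure G S \<lhd> G"
proof -
  have ne: "{N. N \<lhd> G \<and> S \<subseteq> N} \<noteq> {}"
    using assms normal_invI[OF subgroup_self] by auto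
  show ?thesis
    unfolding normal_closure_def
  proof (rule normal_invI)
    show "subgroup (\<Inter>{N. N \<lhd> G \<and> S \<subseteq> N}) G"
      using ne by (intro subgroups_Inter) (auto dest: normal_imp_subgroup)
  qed (auto simp: normal_inv_iff)
qed

definition presented_group :: "presentation \<Rightarrow> word set set monoid" where
  "presented_group P =
     free_group (ngens P) Mod
       normal_closure (free_group (ngens P)) ((\<lambda>r. free_rel (ngens P) `` {r}) ` set (rels P))"

definition equivalent :: "presentation \<Rightarrow> presentation \<Rightarrow> bool" where
  "equivalent P Q \<longleftrightarrow> presented_group P \<cong> presented_group Q"


section \<open>Sizes\<close>

definition unary_size :: "presentation \<Rightarrow> nat" where
  "unary_size P = ngens P + (\<Sum>r\<leftarrow>rels P. length r)"

text \<open>The decomposition of a word into maximal powers of letters, as (letter, exponent) pairs: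
  exponents are positive and adjacent letters differ.\<close>

fun syllables :: "word \<Rightarrow> (letter \<times> nat) list" where
  "syllables [] = []"
| "syllables (x # w) =
     (case syllables w of
        [] \<Rightarrow> [(x, 1)]
      | (y, k) # s \<Rightarrow> if x = y then (y, Suc k) # s else (x, 1) # (y, k) # s)"

text \<open>The exponents of a generator and of its inverse are both taken into account.  The value is
  \<open>0\<close> for generators that do not occur.\<close>

definition max_exponent :: "presentation \<Rightarrow> nat \<Rightarrow> nat" where
  "max_exponent P g = Max (insert 0 {k. \<exists>r\<in>set (rels P). \<exists>b. ((g, b), k) \<in> set (syllables r)})"

text \<open>A maximal exponent \<open>m\<close> costs \<open>\<lceil>log 2 m\<rceil>\<close> bits, but at least one: the logarithm
  vanishes for \<open>m = 1\<close>, and without the lower bound the presentations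
  \<open>\<langle>a, b; (ab)\<^sup>k, 1\<rangle>\<close> of the groups \<open>\<int> * \<int>/k\<close> would all have binary size \<open>2\<close>.\<close>

definition exponent_bits :: "nat \<Rightarrow> nat" where
  "exponent_bits m = max 1 (nat \<lceil>log 2 (real m)\<rceil>)"

definition word_binary_size :: "presentation \<Rightarrow> word \<Rightarrow> nat" where
  "word_binary_size P r = (\<Sum>(x, k)\<leftarrow>syllables r. exponent_bits (max_exponent P (fst x)))"

definition binary_size :: "presentation \<Rightarrow> nat" where
  "binary_size P = ngens P + (\<Sum>r\<leftarrow>rels P. word_binary_size P r)"

lemma syllables_expand: "concat (map (\<lambda>(x, k). replicate k x) (syllables w)) = w"
  by (induction w) (auto split: list.split prod.split if_splits)

lemma syllables_pos: "(x, k) \<in> set (syllables w) \<Longrightarrow> 0 < k"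
  by (induction w arbitrary: x k) (auto split: list.splits prod.splits if_splits)

lemma syllables_adjacent: "successively (\<noteq>) (map fst (syllables w))"
  by (induction w) (auto split: list.split prod.split)

lemma finite_exponents:
  "finite {k. \<exists>r\<in>set (rels P). \<exists>b. ((g, b), k) \<in> set (syllables r)}"
proof (rule finite_subset)
  show "{k. \<exists>r\<in>set (rels P). \<exists>b. ((g, b), k) \<in> set (syllables r)}
      \<subseteq> (\<Union>r\<in>set (rels P). snd ` set (syllables r))"
    by force
qed simp

end

theory Submission
  imports Defs
begin

text \<open>Replace a generator \<open>g\<close> by generators for its powers with exponents
  \<open>1, 2, 4, \<dots>, 2\<^sup>c\<close>, where \<open>c = \<lceil>log 2 m\<rceil>\<close> for the maximal exponent \<open>m\<close> of
  \<open>g\<close>, with relations saying that each is the square of the preceding one, and write every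
  exponent in binary.  A syllable in \<open>g\<close> becomes a word of length at most \<open>c + 1\<close>, and the new
  generators and relations for \<open>g\<close> are paid for by a single syllable in \<open>g\<close>.  The presented groups
  are isomorphic by the universal property.  Addressing cost is not part of the unary size, so
  the bound already holds without the factor \<open>log n\<close>.\<close>

section \<open>Evaluation of words\<close>

definition letter_val :: "('a, 'b) monoid_scheme \<Rightarrow> (nat \<Rightarrow> 'a) \<Rightarrow> letter \<Rightarrow> 'a" where
  "letter_val G a x = (if snd x then a (fst x) else inv\<^bsub>G\<^esub> (a (fst x)))"

primrec word_val :: "('a, 'b) monoid_scheme \<Rightarrow> (nat \<Rightarrow> 'a) \<Rightarrow> word \<Rightarrow> 'a" where
  "word_val G a [] = \<one>\<^bsub>G\<^esub>"
| "word_val G a (x # w) = letter_val G a x \<otimes>\<^bsub>G\<^esub> word_val G a w"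

lemma singleton_words [simp]: "[x] \<in> words n \<longleftrightarrow> fst x < n"
  by (cases x) (auto simp: words_def)

lemma Cons_words [simp]: "x # w \<in> words n \<longleftrightarrow> fst x < n \<and> w \<in> words n"
  using words_Cons[of x w n] by simp

lemma words_iff: "w \<in> words n \<longleftrightarrow> (\<forall>x\<in>set w. fst x < n)"
  by (induction w) auto

lemma word_val_cong:
  assumes "w \<in> words n" "\<And>i. i < n \<Longrightarrow> a i = b i"
  shows "word_val G a w = word_val G b w"
  using assms(1) by (induction w) (auto simp: letter_val_def assms(2))

context group
begin

lemma letter_val_closed [intro]:
  "\<lbrakk>a \<in> {..<n} \<rightarrow> carrier G; fst x < n\<rbrakk> \<Longrightarrow> letter_val G a x \<in> carrier G"
  by (auto simp: letter_val_def)

lemma word_val_closed [intro]: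
  "\<lbrakk>a \<in> {..<n} \<rightarrow> carrier G; w \<in> words n\<rbrakk> \<Longrightarrow> word_val G a w \<in> carrier G"
  by (induction w) auto

lemma word_val_append:
  assumes "a \<in> {..<n} \<rightarrow> carrier G" "u \<in> words n" "v \<in> words n"
  shows "word_val G a (u @ v) = word_val G a u \<otimes> word_val G a v"
  using assms(2)
proof (induction u)
  case Nil
  then show ?case using assms by (simp add: word_val_closed)
next
  case (Cons x u)
  then have "letter_val G a x \<in> carrier G" "word_val G a u \<in> carrier G" "word_val G a v \<in> carrier G"
    using assms by auto
  then show ?case using Cons by (simp add: m_assoc)
qed

lemma word_val_cancel:
  assumes "a \<in> {..<n} \<rightarrow> carrier G" "fst x < n"
  shows "word_val G a [x, inv_letter x] = \<one>"
  using assms by (auto simp: letter_val_def inv_letter_def Pi_iff)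

text \<open>This makes evaluation well defined on the classes forming the free group. Only the
  cancellation rule has content, since equality of values is an equivalence relation.\<close>

lemma word_val_free_rel:
  assumes "a \<in> {..<n} \<rightarrow> carrier G" "(u, v) \<in> free_rel n"
  shows "word_val G a u = word_val G a v"
  using assms(2)
proof induction
  case (cancel u v x)
  then have "[x, inv_letter x] \<in> words n"
    by (simp add: inv_letter_def)
  then have "word_val G a (u @ [x, inv_letter x] @ v)
      = word_val G a u \<otimes> (word_val G a [x, inv_letter x] \<otimes> word_val G a v)"
    using cancel words_append by (metis word_val_append[OF assms(1)])
  also have "\<dots> = word_val G a (u @ v)"
  proof -
    have "word_val G a [x, inv_letter x] = \<one>"
      using cancel by (intro word_val_cancel[OF assms(1)]) simp
    then show ?thesis
      using cancel word_val_append[OF assms(1)] word_val_closed[OF assms(1)]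
      by (simp del: word_val.simps)
  qed
  finally show ?case .
qed auto

lemma word_val_replicate:
  assumes "a \<in> {..<n} \<rightarrow> carrier G" "fst x < n"
  shows "word_val G a (replicate k x) = letter_val G a x [^] k"
  using letter_val_closed[OF assms]
  by (induction k) (simp_all add: nat_pow_Suc2[symmetric] del: nat_pow_Suc)

end

text \<open>Used to compute composites of homomorphisms: applying \<open>h\<close> to a value only
  changes the images of the generators.\<close>

lemma (in group_hom) hom_word_val:
  assumes "a \<in> {..<n} \<rightarrow> carrier G" "w \<in> words n"
  shows "h (word_val G a w) = word_val H (\<lambda>i. h (a i)) w"
  using assms(2)
proof (induction w)
  case (Cons x w)
  then have "letter_val G a x \<in> carrier G" "word_val G a w \<in> carrier G"
    using assms(1) by auto
  moreover have "h (letter_val G a x) = letter_val H (\<lambda>i. h (a i)) x"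
    using assms(1) Cons.prems by (auto simp: letter_val_def Pi_iff)
  ultimately show ?case using Cons by simp
qed simp


section \<open>The universal property of a presented group\<close>

text \<open>The element of \<open>presented_group P\<close> represented by \<open>w\<close>. It is a
  coset whose members are classes of words, hence the nested sets.\<close>

definition word_class :: "presentation \<Rightarrow> word \<Rightarrow> word set set" where
  "word_class P w =
     normal_closure (free_group (ngens P)) ((\<lambda>r. free_rel (ngens P) `` {r}) ` set (rels P))
       #>\<^bsub>free_group (ngens P)\<^esub> (free_rel (ngens P) `` {w})"

lemma carrier_free_group: "carrier (free_group n) = (\<lambda>u. free_rel n `` {u}) ` words n"
  by (auto simp: free_group_def quotient_def)

lemma one_free_group: "\<one>\<^bsub>free_group n\<^esub> = free_rel n `` {[]}"
  by (simp add: free_group_def)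

lemma normal_closure_least: "\<lbrakk>N \<lhd> G; S \<subseteq> N\<rbrakk> \<Longrightarrow> normal_closure G S \<subseteq> N"
  by (auto simp: normal_closure_def)

lemma normal_closure_superset: "S \<subseteq> normal_closure G S"
  by (auto simp: normal_closure_def)

lemma free_group_hom:
  assumes "group H" "a \<in> {..<n} \<rightarrow> carrier H"
  obtains h where "h \<in> hom (free_group n) H"
    "\<And>w. w \<in> words n \<Longrightarrow> h (free_rel n `` {w}) = word_val H a w"
proof -
  interpret H: group H by fact
  \<comment> \<open>Evaluate an arbitrary representative; by \<open>word_val_free_rel\<close> the
    choice does not affect the value.\<close>
  define h where "h A = word_val H a (SOME u. u \<in> A)" for A
  have val_closed: "word_val H a w \<in> carrier H" if "w \<in> words n" for w
    using assms(2) that by (rule H.word_val_closed)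
  have h: "h (free_rel n `` {w}) = word_val H a w" if "w \<in> words n" for w
  proof -
    have "w \<in> free_rel n `` {w}"
      using that by (simp add: free_rel.refl)
    then have "(SOME u. u \<in> free_rel n `` {w}) \<in> free_rel n `` {w}"
      by (rule someI)
    then show ?thesis
      unfolding h_def using H.word_val_free_rel[OF assms(2)] by auto
  qed
  moreover have "h \<in> hom (free_group n) H"
    by (rule homI)
      (use assms in \<open>auto simp: carrier_free_group free_group_mult h H.word_val_append val_closed\<close>)
  ultimately show thesis using that by blast
qed

locale presented =
  fixes P :: presentation
  assumes rels: "set (rels P) \<subseteq> words (ngens P)"
begin

abbreviation "relators \<equiv> (\<lambda>r. free_rel (ngens P) `` {r}) ` set (rels P)"

lemma normal: "normal_closure (free_group (ngens P)) relators \<lhd> free_group (ngens P)"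
  using rels by (intro group.normal_closure_normal group_free_group) (auto simp: carrier_free_group)

lemma group_presented_group: "group (presented_group P)"
  unfolding presented_group_def by (rule normal.factorgroup_is_group[OF normal])

lemma carrier_presented_group: "carrier (presented_group P) = word_class P ` words (ngens P)"
  by (auto simp: presented_group_def carrier_FactGroup carrier_free_group word_class_def)

lemma word_class_closed: "w \<in> words (ngens P) \<Longrightarrow> word_class P w \<in> carrier (presented_group P)"
  by (simp add: carrier_presented_group)

lemma word_class_append:
  "\<lbrakk>u \<in> words (ngens P); v \<in> words (ngens P)\<rbrakk>
    \<Longrightarrow> word_class P (u @ v) = word_class P u \<otimes>\<^bsub>presented_group P\<^esub> word_class P v"
  unfolding word_class_def presented_group_def
  by (simp add: normal.rcos_sum[OF normal] carrier_free_group free_group_mult)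

lemma word_class_trivial:
  assumes "w \<in> words (ngens P)"
    "free_rel (ngens P) `` {w} \<in> normal_closure (free_group (ngens P)) relators"
  shows "word_class P w = \<one>\<^bsub>presented_group P\<^esub>"
  unfolding word_class_def presented_group_def one_FactGroup
  using assms normal_imp_subgroup[OF normal]
  by (intro group.coset_join2 group_free_group) (auto simp: carrier_free_group)

lemma word_class_Nil: "word_class P [] = \<one>\<^bsub>presented_group P\<^esub>"
  using subgroup.one_closed[OF normal_imp_subgroup[OF normal]]
  by (intro word_class_trivial) (simp_all add: one_free_group)

lemma word_class_rel: "r \<in> set (rels P) \<Longrightarrow> word_class P r = \<one>\<^bsub>presented_group P\<^esub>"
  using rels normal_closure_superset[of relators] by (intro word_class_trivial) auto

definition gen :: "nat \<Rightarrow> word set set" where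
  "gen i = word_class P [(i, True)]"

lemma gen_closed: "gen \<in> {..<ngens P} \<rightarrow> carrier (presented_group P)"
  by (simp add: gen_def word_class_closed)

text \<open>Passes between words and group elements: the class of a word can be computed by
  evaluating it at the canonical generators.\<close>

lemma word_val_gen:
  "w \<in> words (ngens P) \<Longrightarrow> word_val (presented_group P) gen w = word_class P w"
proof (induction w)
  case Nil
  show ?case by (simp add: word_class_Nil)
next
  case (Cons x w)
  interpret G: group "presented_group P" by (rule group_presented_group)
  obtain i s where x: "x = (i, s)" by (cases x)
  have i: "i < ngens P" using Cons.prems x by simp
  \<comment> \<open>\<open>letter_val\<close> uses the group inverse, while a word has its own
    letter for the inverse generator; cancellation identifies the two.\<close>
  have "word_class P [(i, False), (i, True)] = \<one>\<^bsub>presented_group P\<^esub>"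
  proof -
    have "([] @ [(i, False), inv_letter (i, False)] @ [], [] @ []) \<in> free_rel (ngens P)"
      by (rule free_rel.cancel) (use i in auto)
    then have "free_rel (ngens P) `` {[(i, False), (i, True)]} = free_rel (ngens P) `` {[]}"
      by (intro equiv_class_eq[OF equiv_free_rel]) (simp add: inv_letter_def)
    then show ?thesis by (simp add: word_class_def flip: word_class_Nil)
  qed
  then have "inv\<^bsub>presented_group P\<^esub> gen i = word_class P [(i, False)]"
    using i word_class_append[of "[(i, False)]" "[(i, True)]"]
    by (intro G.inv_equality) (simp_all add: gen_def word_class_closed)
  then have "letter_val (presented_group P) gen x = word_class P [x]"
    by (simp add: letter_val_def x gen_def)
  then show ?case
    using Cons word_class_append[of "[x]" w] by simp
qed

lemma word_val_gen_rel:
  "r \<in> set (rels P) \<Longrightarrow> word_val (presented_group P) gen r = \<one>\<^bsub>presented_group P\<^esub>"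
  using word_val_gen[OF subsetD[OF rels]] word_class_rel by simp

text \<open>Von Dyck's theorem. The induced map on the free group has a normal kernel containing the
  relators, hence containing their normal closure, so it factors through the quotient.\<close>

lemma presented_group_hom:
  assumes "group H" "a \<in> {..<ngens P} \<rightarrow> carrier H"
    and rels_val: "\<And>r. r \<in> set (rels P) \<Longrightarrow> word_val H a r = \<one>\<^bsub>H\<^esub>"
  obtains h where "h \<in> hom (presented_group P) H"
    "\<And>w. w \<in> words (ngens P) \<Longrightarrow> h (word_class P w) = word_val H a w"
proof -
  obtain f where f: "f \<in> hom (free_group (ngens P)) H"
    "\<And>w. w \<in> words (ngens P) \<Longrightarrow> f (free_rel (ngens P) `` {w}) = word_val H a w"
    using free_group_hom[OF assms(1,2)] by blast
  interpret f: group_hom "free_group (ngens P)" H f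
    using f(1) assms(1) group_free_group by (simp add: group_hom_def group_hom_axioms_def)
  have "relators \<subseteq> kernel (free_group (ngens P)) H f"
    using rels f(2) rels_val by (auto simp: kernel_def carrier_free_group)
  then have "normal_closure (free_group (ngens P)) relators \<subseteq> kernel (free_group (ngens P)) H f"
    by (intro normal_closure_least f.normal_kernel)
  then obtain h where "h \<in> hom (presented_group P) H"
    "\<And>x. x \<in> carrier (free_group (ngens P)) \<Longrightarrow>
       h (normal_closure (free_group (ngens P)) relators #>\<^bsub>free_group (ngens P)\<^esub> x) = f x"
    unfolding presented_group_def using f.FactGroup_universal_kernel[OF normal] by blast
  then show thesis
    using f(2) by (intro that[of h]) (auto simp: word_class_def carrier_free_group)
qed

end

text \<open>The substitutions \<open>\<sigma>\<close> and \<open>\<tau>\<close> respect the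
  relations and so induce homomorphisms in both directions. These are mutually inverse because both
  composites fix the generators.\<close>

lemma equivalentI:
  fixes \<sigma> \<tau> :: "nat \<Rightarrow> word"
  assumes "presented P" "presented Q"
    and \<sigma>: "\<And>i. i < ngens P \<Longrightarrow> \<sigma> i \<in> words (ngens Q)"
    and \<tau>: "\<And>j. j < ngens Q \<Longrightarrow> \<tau> j \<in> words (ngens P)"
    and rels_\<sigma>: "\<And>r. r \<in> set (rels P) \<Longrightarrow>
      word_val (presented_group Q) (\<lambda>i. word_class Q (\<sigma> i)) r = \<one>\<^bsub>presented_group Q\<^esub>"
    and rels_\<tau>: "\<And>r. r \<in> set (rels Q) \<Longrightarrow>
      word_val (presented_group P) (\<lambda>j. word_class P (\<tau> j)) r = \<one>\<^bsub>presented_group P\<^esub>"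
    and \<tau>_\<sigma>: "\<And>i. i < ngens P \<Longrightarrow>
      word_val (presented_group P) (\<lambda>j. word_class P (\<tau> j)) (\<sigma> i) = word_class P [(i, True)]"
    and \<sigma>_\<tau>: "\<And>j. j < ngens Q \<Longrightarrow>
      word_val (presented_group Q) (\<lambda>i. word_class Q (\<sigma> i)) (\<tau> j) = word_class Q [(j, True)]"
  shows "equivalent P Q"
proof -
  interpret P: presented P by fact
  interpret Q: presented Q by fact
  let ?a = "\<lambda>i. word_class Q (\<sigma> i)" and ?b = "\<lambda>j. word_class P (\<tau> j)"
  have a: "?a \<in> {..<ngens P} \<rightarrow> carrier (presented_group Q)"
    using \<sigma> by (simp add: Q.word_class_closed)
  have b: "?b \<in> {..<ngens Q} \<rightarrow> carrier (presented_group P)"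
    using \<tau> by (simp add: P.word_class_closed)
  obtain f where f: "f \<in> hom (presented_group P) (presented_group Q)"
    "\<And>w. w \<in> words (ngens P) \<Longrightarrow> f (word_class P w) = word_val (presented_group Q) ?a w"
    using P.presented_group_hom[OF Q.group_presented_group a rels_\<sigma>] by blast
  obtain g where g: "g \<in> hom (presented_group Q) (presented_group P)"
    "\<And>w. w \<in> words (ngens Q) \<Longrightarrow> g (word_class Q w) = word_val (presented_group P) ?b w"
    using Q.presented_group_hom[OF P.group_presented_group b rels_\<tau>] by blast
  interpret f: group_hom "presented_group P" "presented_group Q" f
    using f(1) P.group_presented_group Q.group_presented_group
    by (simp add: group_hom_def group_hom_axioms_def)
  interpret g: group_hom "presented_group Q" "presented_group P" g
    using g(1) P.group_presented_group Q.group_presented_group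
    by (simp add: group_hom_def group_hom_axioms_def)
  have "g (f (word_class P w)) = word_class P w" if w: "w \<in> words (ngens P)" for w
  proof -
    have "g (f (word_class P w)) = word_val (presented_group P) (\<lambda>i. g (?a i)) w"
      using w by (simp add: f(2) g.hom_word_val[OF a])
    \<comment> \<open>The composite evaluates \<open>w\<close> at the images of the generators,
      which by \<open>\<tau>_\<sigma>\<close> are the generators themselves.\<close>
    also have "\<dots> = word_val (presented_group P) P.gen w"
      by (rule word_val_cong[OF w]) (simp add: g(2) \<sigma> \<tau>_\<sigma> P.gen_def)
    finally show ?thesis using w by (simp add: P.word_val_gen)
  qed
  moreover have "f (g (word_class Q w)) = word_class Q w" if w: "w \<in> words (ngens Q)" for w
  proof -
    have "f (g (word_class Q w)) = word_val (presented_group Q) (\<lambda>j. f (?b j)) w"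
      using w by (simp add: g(2) f.hom_word_val[OF b])
    also have "\<dots> = word_val (presented_group Q) Q.gen w"
      by (rule word_val_cong[OF w]) (simp add: f(2) \<tau> \<sigma>_\<tau> Q.gen_def)
    finally show ?thesis using w by (simp add: Q.word_val_gen)
  qed
  ultimately have "group_isomorphisms (presented_group P) (presented_group Q) f g"
    using f(1) g(1)
    by (auto simp: group_isomorphisms_def P.carrier_presented_group Q.carrier_presented_group)
  then show ?thesis
    unfolding equivalent_def by (metis group_isomorphisms_imp_iso is_isoI)
qed


section \<open>Binary expansion of exponents\<close>

text \<open>One letter for each set bit of the exponent, all with the sign of the syllable. Bits
  above position \<open>c\<close> of the generator are dropped, so the exponent must be below
  \<open>2 ^ Suc c\<close> for this to be faithful.\<close>

definition power_word :: "(nat \<times> nat \<Rightarrow> nat) \<Rightarrow> (nat \<Rightarrow> nat) \<Rightarrow> letter \<times> nat \<Rightarrow> word" where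
  "power_word idx c = (\<lambda>(x, k).
     map (\<lambda>j. (idx (fst x, j), snd x)) (filter (bit k) [0..<Suc (c (fst x))]))"

definition compress :: "(nat \<times> nat \<Rightarrow> nat) \<Rightarrow> (nat \<Rightarrow> nat) \<Rightarrow> word \<Rightarrow> word" where
  "compress idx c r = concat (map (power_word idx c) (syllables r))"

definition square_rels :: "(nat \<times> nat \<Rightarrow> nat) \<Rightarrow> (nat \<Rightarrow> nat) \<Rightarrow> nat \<Rightarrow> word list" where
  "square_rels idx c n = concat (map (\<lambda>g.
     map (\<lambda>j. [(idx (g, j), True), (idx (g, j), True), (idx (g, Suc j), False)]) [0..<c g]) [0..<n])"

text \<open>Pairs name the new generators; a bijection \<open>idx\<close> onto an initial segment
  turns them into the numbers that a presentation requires.\<close>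

definition power_index :: "(nat \<Rightarrow> nat) \<Rightarrow> nat \<Rightarrow> (nat \<times> nat) set" where
  "power_index c n = (SIGMA g:{..<n}. {..c g})"

text \<open>The generator \<open>idx (g, j)\<close> stands for the power of \<open>g\<close> with exponent \<open>2 ^ j\<close>.\<close>

definition compressed ::
    "(nat \<times> nat \<Rightarrow> nat) \<Rightarrow> (nat \<Rightarrow> nat) \<Rightarrow> presentation \<Rightarrow> presentation" where
  "compressed idx c P =
     \<lparr>ngens = card (power_index c (ngens P)),
      rels = map (compress idx c) (rels P) @ square_rels idx c (ngens P)\<rparr>"

section \<open>Values of compressed words in an arbitrary group\<close>

lemma syllables_letter: "(x, k) \<in> set (syllables w) \<Longrightarrow> x \<in> set w"
  using syllables_pos[of x k w] arg_cong[OF syllables_expand[of w], of set] by force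

lemma power_words_val:
  assumes "group H" "d \<in> {..<N} \<rightarrow> carrier H"
    and idx: "\<And>j. j \<le> c g \<Longrightarrow> idx (g, j) < N"
    and sq: "\<And>j. j \<le> c g \<Longrightarrow> d (idx (g, j)) = d (idx (g, 0)) [^]\<^bsub>H\<^esub> (2 ^ j :: nat)"
    and k: "k < 2 ^ Suc (c g)"
  shows "word_val H d (power_word idx c ((g, s), k))
    = letter_val H (\<lambda>g. d (idx (g, 0))) (g, s) [^]\<^bsub>H\<^esub> k"
proof -
  interpret H: group H by fact
  let ?z = "letter_val H (\<lambda>g. d (idx (g, 0))) (g, s)"
  have d0: "d (idx (g, 0)) \<in> carrier H"
    using assms(2) idx[of 0] by auto
  then have z: "?z \<in> carrier H"
    by (simp add: letter_val_def)
  have letter: "letter_val H d (idx (g, j), s) = ?z [^]\<^bsub>H\<^esub> (2 ^ j :: nat)" if "j \<le> c g" for j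
    using sq[OF that] d0 by (simp add: letter_val_def H.nat_pow_inv)
  \<comment> \<open>Induction on the number of low bits read so far: they contribute the exponent
    \<open>take_bit m k\<close>, which is \<open>k\<close> itself once \<open>m\<close> reaches
    \<open>Suc (c g)\<close>.\<close>
  have "word_val H d (map (\<lambda>j. (idx (g, j), s)) (filter (bit k) [0..<m]))
      = ?z [^]\<^bsub>H\<^esub> take_bit m k" if "m \<le> Suc (c g)" for m
    using that
  proof (induction m)
    case (Suc m)
    have "map (\<lambda>j. (idx (g, j), s)) (filter (bit k) [0..<m]) \<in> words N"
      using Suc.prems idx by (auto simp: words_iff)
    moreover have "idx (g, m) < N"
      using Suc.prems idx by simp
    ultimately show ?case
      using Suc letter[of m] z
      by (simp add: H.word_val_append[OF assms(2)] H.nat_pow_mult take_bit_Suc_from_most add.commute)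
  qed simp
  from this[of "Suc (c g)"] k show ?thesis
    by (simp add: power_word_def take_bit_nat_eq_self del: upt_Suc)
qed

text \<open>Replaces syllables one by one. The list \<open>xs\<close> is arbitrary, since the
  merging in \<open>syllables\<close> would obstruct a direct induction on the word.\<close>

lemma word_val_syllables:
  assumes "group H" "a \<in> {..<n} \<rightarrow> carrier H" "d \<in> {..<N} \<rightarrow> carrier H"
    and "\<And>x k. (x, k) \<in> set xs \<Longrightarrow> fst x < n \<and> f (x, k) \<in> words N \<and>
      word_val H d (f (x, k)) = letter_val H a x [^]\<^bsub>H\<^esub> (k :: nat)"
  shows "word_val H d (concat (map f xs)) = word_val H a (concat (map (\<lambda>(x, k). replicate k x) xs))"
  using assms(4)
proof (induction xs)
  case (Cons y xs)
  interpret H: group H by fact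
  obtain x k where y: "y = (x, k)" by (cases y)
  have "concat (map f xs) \<in> words N"
    using Cons.prems by (force simp: words_iff)
  moreover have "concat (map (\<lambda>(x, k). replicate k x) xs) \<in> words n"
    using Cons.prems by (force simp: words_iff)
  moreover have "replicate k x \<in> words n"
    using Cons.prems[of x k] y by (simp add: words_iff)
  moreover have "fst x < n" "f (x, k) \<in> words N"
    "word_val H d (f (x, k)) = letter_val H a x [^]\<^bsub>H\<^esub> k"
    using Cons.prems[of x k] y by simp_all
  moreover have "word_val H d (concat (map f xs))
      = word_val H a (concat (map (\<lambda>(x, k). replicate k x) xs))"
    by (rule Cons.IH, rule Cons.prems) simp
  ultimately show ?case
    by (simp add: y H.word_val_append[OF assms(2)] H.word_val_append[OF assms(3)]
        H.word_val_replicate[OF assms(2)])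
qed simp

lemma power_word_words:
  assumes "\<And>j. j \<le> c (fst x) \<Longrightarrow> idx (fst x, j) < N"
  shows "power_word idx c (x, k) \<in> words N"
  using assms by (auto simp: power_word_def words_iff)

text \<open>Stated for any group with the right powers, because it serves twice: relations of
  \<open>P\<close> are checked in the compressed group, and compressed relations in the group of
  \<open>P\<close>.\<close>

lemma word_val_compress:
  assumes "group H" "d \<in> {..<N} \<rightarrow> carrier H"
    and idx: "\<And>g j. \<lbrakk>g < n; j \<le> c g\<rbrakk> \<Longrightarrow> idx (g, j) < N"
    and sq: "\<And>g j. \<lbrakk>g < n; j \<le> c g\<rbrakk> \<Longrightarrow> d (idx (g, j)) = d (idx (g, 0)) [^]\<^bsub>H\<^esub> (2 ^ j :: nat)"
    and r: "r \<in> words n"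
    and k: "\<And>g s k. ((g, s), k) \<in> set (syllables r) \<Longrightarrow> k < 2 ^ Suc (c g)"
  shows "word_val H d (compress idx c r) = word_val H (\<lambda>g. d (idx (g, 0))) r"
proof -
  have "(\<lambda>g. d (idx (g, 0))) \<in> {..<n} \<rightarrow> carrier H"
    using assms(2) idx by auto
  moreover have "fst x < n \<and> power_word idx c (x, k) \<in> words N \<and>
      word_val H d (power_word idx c (x, k)) = letter_val H (\<lambda>g. d (idx (g, 0))) x [^]\<^bsub>H\<^esub> k"
    if "(x, k) \<in> set (syllables r)" for x k
  proof -
    obtain g s where x: "x = (g, s)" by (cases x)
    have "g < n"
      using syllables_letter[OF that] r x by (auto simp: words_iff)
    moreover have "power_word idx c (x, k) \<in> words N"
      by (rule power_word_words) (use idx \<open>g < n\<close> x in simp)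
    moreover have "word_val H d (power_word idx c ((g, s), k))
        = letter_val H (\<lambda>g. d (idx (g, 0))) (g, s) [^]\<^bsub>H\<^esub> k"
      using idx[OF \<open>g < n\<close>] sq[OF \<open>g < n\<close>] k[OF that[unfolded x]]
      by (rule power_words_val[OF assms(1,2)])
    ultimately show ?thesis
      by (simp add: x)
  qed
  ultimately have "word_val H d (concat (map (power_word idx c) (syllables r)))
      = word_val H (\<lambda>g. d (idx (g, 0))) (concat (map (\<lambda>(x, k). replicate k x) (syllables r)))"
    by (rule word_val_syllables[OF assms(1) _ assms(2)])
  then show ?thesis
    by (simp only: compress_def syllables_expand)
qed

section \<open>Equivalence of a presentation with its compression\<close>

lemma set_square_rels:
  "r \<in> set (square_rels idx c n) \<longleftrightarrow> (\<exists>g<n. \<exists>j<c g.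
     r = [(idx (g, j), True), (idx (g, j), True), (idx (g, Suc j), False)])"
  by (force simp: square_rels_def)

lemma compress_words:
  assumes "r \<in> words n" and idx: "\<And>g j. \<lbrakk>g < n; j \<le> c g\<rbrakk> \<Longrightarrow> idx (g, j) < N"
  shows "compress idx c r \<in> words N"
proof -
  have "power_word idx c (x, k) \<in> words N" if "(x, k) \<in> set (syllables r)" for x k
    using syllables_letter[OF that] assms by (intro power_word_words) (auto simp: words_iff)
  then show ?thesis
    unfolding compress_def words_iff by force
qed

text \<open>The generator \<open>g\<close> corresponds to \<open>idx (g, 0)\<close>, and
  \<open>idx (g, j)\<close> to the power of \<open>g\<close> with exponent \<open>2 ^ j\<close>. The
  square relations force these powers in the new group and hold for them in the old one.\<close>

lemma equivalent_compressed:
  assumes P: "set (rels P) \<subseteq> words (ngens P)"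
    and idx: "bij_betw idx (power_index c (ngens P)) {..<card (power_index c (ngens P))}"
    and c: "\<And>r g s k. \<lbrakk>r \<in> set (rels P); ((g, s), k) \<in> set (syllables r)\<rbrakk> \<Longrightarrow> k < 2 ^ Suc (c g)"
  shows "set (rels (compressed idx c P)) \<subseteq> words (ngens (compressed idx c P))"
    and "equivalent P (compressed idx c P)"
proof -
  let ?Q = "compressed idx c P" and ?N = "card (power_index c (ngens P))"
  have ngens_Q: "ngens ?Q = ?N"
    by (simp add: compressed_def)
  have rels_Q: "set (rels ?Q) = compress idx c ` set (rels P) \<union> set (square_rels idx c (ngens P))"
    by (simp add: compressed_def)
  have idx_less: "idx (g, j) < ?N" if "g < ngens P" "j \<le> c g" for g j
    using bij_betwE[OF idx] that by (auto simp: power_index_def)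
  show sub: "set (rels ?Q) \<subseteq> words (ngens ?Q)"
    using P idx_less compress_words[of _ "ngens P" c idx ?N]
    by (auto simp: rels_Q ngens_Q set_square_rels)
  interpret P: presented P using P by unfold_locales
  interpret Q: presented ?Q using sub by unfold_locales
  interpret GP: group "presented_group P" by (rule P.group_presented_group)
  interpret GQ: group "presented_group ?Q" by (rule Q.group_presented_group)
  \<comment> \<open>\<open>dec\<close> recovers the pair named by a new generator, so that
    \<open>\<tau>\<close> can write out the corresponding power.\<close>
  define dec where "dec = the_inv_into (power_index c (ngens P)) idx"
  define \<sigma> :: "nat \<Rightarrow> word" where "\<sigma> g = [(idx (g, 0), True)]" for g
  define \<tau> :: "nat \<Rightarrow> word" where "\<tau> i = replicate (2 ^ snd (dec i)) (fst (dec i), True)" for i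
  have dec: "dec (idx (g, j)) = (g, j)" if "g < ngens P" "j \<le> c g" for g j
    unfolding dec_def using that idx
    by (intro the_inv_into_f_f) (auto simp: bij_betw_def power_index_def)
  have idx_cases: "\<exists>g j. i = idx (g, j) \<and> g < ngens P \<and> j \<le> c g" if "i < ?N" for i
  proof -
    have "i \<in> idx ` power_index c (ngens P)"
      using idx that by (simp add: bij_betw_def)
    then show ?thesis
      unfolding power_index_def by blast
  qed
  have \<sigma>_class: "(\<lambda>g. word_class ?Q (\<sigma> g)) = (\<lambda>g. Q.gen (idx (g, 0)))"
    by (simp add: \<sigma>_def Q.gen_def)
  have \<tau>_class: "word_class P (\<tau> (idx (g, j))) = P.gen g [^]\<^bsub>presented_group P\<^esub> (2 ^ j :: nat)"
    if "g < ngens P" "j \<le> c g" for g j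
  proof -
    have "word_class P (\<tau> (idx (g, j))) = word_val (presented_group P) P.gen (\<tau> (idx (g, j)))"
      using that by (intro P.word_val_gen[symmetric]) (simp add: \<tau>_def dec words_iff)
    then show ?thesis
      using that GP.word_val_replicate[OF P.gen_closed] by (simp add: \<tau>_def dec letter_val_def)
  qed
  have Pgen: "P.gen g \<in> carrier (presented_group P)" if "g < ngens P" for g
    using P.gen_closed that by auto
  have Qgen: "Q.gen (idx (g, j)) \<in> carrier (presented_group ?Q)" if "g < ngens P" "j \<le> c g" for g j
    using Q.gen_closed idx_less[OF that] by (auto simp: ngens_Q)
  have \<tau>_closed: "(\<lambda>i. word_class P (\<tau> i)) \<in> {..<?N} \<rightarrow> carrier (presented_group P)"
  proof
    fix i assume "i \<in> {..<?N}"
    then obtain g j where "i = idx (g, j)" "g < ngens P" "j \<le> c g"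
      using idx_cases by blast
    then show "word_class P (\<tau> i) \<in> carrier (presented_group P)"
      by (simp add: \<tau>_class Pgen)
  qed
  have \<tau>_powers: "word_class P (\<tau> (idx (g, j)))
      = word_class P (\<tau> (idx (g, 0))) [^]\<^bsub>presented_group P\<^esub> (2 ^ j :: nat)"
    if "g < ngens P" "j \<le> c g" for g j
    using that by (simp add: \<tau>_class Pgen)
  have square: "Q.gen (idx (g, Suc j)) =
      Q.gen (idx (g, j)) \<otimes>\<^bsub>presented_group ?Q\<^esub> Q.gen (idx (g, j))" if "g < ngens P" "j < c g" for g j
  proof -
    let ?r = "[(idx (g, j), True), (idx (g, j), True), (idx (g, Suc j), False)]"
    have r: "?r \<in> set (rels ?Q)"
      unfolding rels_Q using that by (auto simp: set_square_rels)
    then have "word_val (presented_group ?Q) Q.gen ?r = \<one>\<^bsub>presented_group ?Q\<^esub>"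
      by (rule Q.word_val_gen_rel)
    then have "(Q.gen (idx (g, j)) \<otimes>\<^bsub>presented_group ?Q\<^esub> Q.gen (idx (g, j)))
        \<otimes>\<^bsub>presented_group ?Q\<^esub> inv\<^bsub>presented_group ?Q\<^esub> Q.gen (idx (g, Suc j)) = \<one>\<^bsub>presented_group ?Q\<^esub>"
      using that Qgen[of g j] Qgen[of g "Suc j"] by (simp add: letter_val_def GQ.m_assoc)
    \<comment> \<open>The square is a left inverse of the inverse of the next generator, hence equal
      to that generator.\<close>
    then have "inv\<^bsub>presented_group ?Q\<^esub> (inv\<^bsub>presented_group ?Q\<^esub> Q.gen (idx (g, Suc j)))
        = Q.gen (idx (g, j)) \<otimes>\<^bsub>presented_group ?Q\<^esub> Q.gen (idx (g, j))"
      using that by (intro GQ.inv_equality) (simp_all add: Qgen)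
    then show ?thesis
      using that by (simp add: Qgen)
  qed
  have powers: "Q.gen (idx (g, j)) = Q.gen (idx (g, 0)) [^]\<^bsub>presented_group ?Q\<^esub> (2 ^ j :: nat)"
    if "g < ngens P" "j \<le> c g" for g j
    using that(2)
  proof (induction j)
    case 0
    then show ?case using Qgen[of g 0] that by simp
  next
    case (Suc j)
    then show ?case
      using square[of g j] Qgen[of g 0] that by (simp add: GQ.nat_pow_mult mult_2)
  qed
  show "equivalent P ?Q"
  proof (rule equivalentI[of _ _ \<sigma> \<tau>])
    fix i assume i: "i < ngens P"
    show "\<sigma> i \<in> words (ngens ?Q)"
      using i idx_less by (simp add: \<sigma>_def ngens_Q)
    show "word_val (presented_group P) (\<lambda>j. word_class P (\<tau> j)) (\<sigma> i) = word_class P [(i, True)]"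
      using i Pgen by (simp add: \<sigma>_def letter_val_def \<tau>_class flip: P.gen_def)
  next
    fix j assume "j < ngens ?Q"
    then obtain g l where j: "j = idx (g, l)" "g < ngens P" "l \<le> c g"
      using idx_cases unfolding ngens_Q by blast
    then show "\<tau> j \<in> words (ngens P)"
      by (simp add: \<tau>_def dec words_iff)
    have "(\<lambda>g. Q.gen (idx (g, 0))) \<in> {..<ngens P} \<rightarrow> carrier (presented_group ?Q)"
      using Qgen by auto
    then show "word_val (presented_group ?Q) (\<lambda>i. word_class ?Q (\<sigma> i)) (\<tau> j) = word_class ?Q [(j, True)]"
      using j powers[of g l]
      by (simp add: \<sigma>_class \<tau>_def dec GQ.word_val_replicate letter_val_def flip: Q.gen_def)
  next
    fix r assume r: "r \<in> set (rels P)"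
    \<comment> \<open>An old relation has the same value as its compression, which is a relation of
      the new presentation.\<close>
    have "word_val (presented_group ?Q) (\<lambda>i. word_class ?Q (\<sigma> i)) r
        = word_val (presented_group ?Q) Q.gen (compress idx c r)"
      unfolding \<sigma>_class
      by (rule word_val_compress[symmetric, OF Q.group_presented_group
            Q.gen_closed[unfolded ngens_Q] idx_less powers subsetD[OF P r] c[OF r]])
    also have "\<dots> = \<one>\<^bsub>presented_group ?Q\<^esub>"
      using r by (intro Q.word_val_gen_rel) (simp add: rels_Q)
    finally show "word_val (presented_group ?Q) (\<lambda>i. word_class ?Q (\<sigma> i)) r = \<one>\<^bsub>presented_group ?Q\<^esub>" .
  next
    fix r assume "r \<in> set (rels ?Q)"
    then consider r' where "r' \<in> set (rels P)" "r = compress idx c r'"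
      | g j where "g < ngens P" "j < c g"
          "r = [(idx (g, j), True), (idx (g, j), True), (idx (g, Suc j), False)]"
      unfolding rels_Q set_square_rels Un_iff by blast
    then show "word_val (presented_group P) (\<lambda>j. word_class P (\<tau> j)) r = \<one>\<^bsub>presented_group P\<^esub>"
    proof cases
      case 1
      \<comment> \<open>Conversely, under \<open>\<tau>\<close> a compressed relation has the value
        of the original one.\<close>
      have "word_val (presented_group P) (\<lambda>j. word_class P (\<tau> j)) r
          = word_val (presented_group P) (\<lambda>g. word_class P (\<tau> (idx (g, 0)))) r'"
        unfolding 1(2)
        by (rule word_val_compress[OF P.group_presented_group \<tau>_closed idx_less \<tau>_powers
              subsetD[OF P 1(1)] c[OF 1(1)]])
      also have "\<dots> = word_val (presented_group P) P.gen r'"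
        using P 1(1) Pgen by (intro word_val_cong[where n = "ngens P"]) (auto simp: \<tau>_class)
      also have "\<dots> = \<one>\<^bsub>presented_group P\<^esub>"
        by (rule P.word_val_gen_rel[OF 1(1)])
      finally show ?thesis .
    next
      case 2
      then show ?thesis
        using Pgen[of g]
        by (simp add: letter_val_def \<tau>_class GP.nat_pow_mult mult_2 flip: GP.m_assoc)
    qed
  qed unfold_locales
qed


section \<open>Size of the compressed presentation\<close>

lemma sum_set_le_sum_list:
  fixes f :: "'a \<Rightarrow> nat"
  shows "sum f (set xs) \<le> sum_list (map f xs)"
  by (induction xs) (auto simp: sum.insert_if)

lemma length_square_rels: "length (square_rels idx c n) = sum c {..<n}"
  by (simp add: square_rels_def length_concat comp_def sum_list_sum_nth lessThan_atLeast0)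

lemma card_power_index: "card (power_index c n) = n + sum c {..<n}"
  by (simp add: power_index_def sum_Suc)

text \<open>Each \<open>g\<close> gains \<open>c g\<close> generators and equally many square
  relations, so the surplus of relations over generators is preserved.\<close>

lemma ngens_le_length_rels_compressed:
  assumes "ngens P \<le> length (rels P)"
  shows "ngens (compressed idx c P) \<le> length (rels (compressed idx c P))"
  using assms by (simp add: compressed_def length_square_rels card_power_index)

lemma length_compress:
  "length (compress idx c r) \<le> (\<Sum>(x, k)\<leftarrow>syllables r. Suc (c (fst x)))"
proof -
  have "length (power_word idx c y) \<le> (case y of (x, k) \<Rightarrow> Suc (c (fst x)))" for y
    using length_filter_le[of _ "[0..<Suc (c (fst (fst y)))]"]
    by (auto simp: power_word_def simp del: upt_Suc split: prod.split)
  then show ?thesis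
    unfolding compress_def length_concat map_map by (intro sum_list_mono) simp
qed

text \<open>The factor \<open>4\<close> counts, for each added power, one generator and the three
  letters of its square relation.\<close>

lemma unary_size_compressed:
  "unary_size (compressed idx c P) \<le> ngens P + 4 * sum c {..<ngens P}
     + (\<Sum>r\<leftarrow>rels P. \<Sum>(x, k)\<leftarrow>syllables r. Suc (c (fst x)))"
proof -
  have "map length (square_rels idx c (ngens P)) = replicate (length (square_rels idx c (ngens P))) 3"
    by (rule replicate_eqI) (auto simp: set_square_rels)
  then have "(\<Sum>r\<leftarrow>square_rels idx c (ngens P). length r) = 3 * sum c {..<ngens P}"
    by (simp add: length_square_rels sum_list_replicate)
  moreover have "(\<Sum>r\<leftarrow>rels P. length (compress idx c r))
      \<le> (\<Sum>r\<leftarrow>rels P. \<Sum>(x, k)\<leftarrow>syllables r. Suc (c (fst x)))"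
    by (intro sum_list_mono length_compress)
  ultimately show ?thesis
    by (simp add: unary_size_def compressed_def card_power_index comp_def)
qed

section \<open>Logarithms of the maximal exponents and comparison with the binary size\<close>

definition max_exponent_log :: "presentation \<Rightarrow> nat \<Rightarrow> nat" where
  "max_exponent_log P g = nat \<lceil>log 2 (real (max_exponent P g))\<rceil>"

lemma exponent_less_power:
  assumes "r \<in> set (rels P)" "((g, s), k) \<in> set (syllables r)"
  shows "k < 2 ^ Suc (max_exponent_log P g)"
proof -
  let ?m = "max_exponent P g"
  have "k \<le> ?m"
    unfolding max_exponent_def using assms by (intro Max_ge) (auto simp: finite_exponents)
  moreover have "0 < k"
    using assms by (metis syllables_pos)
  ultimately have m: "0 < ?m" by simp
  have "log 2 (real ?m) \<le> real (max_exponent_log P g)"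
    unfolding max_exponent_log_def by linarith
  then have "real ?m \<le> 2 powr real (max_exponent_log P g)"
    using m by (simp add: log_le_iff)
  then have "real ?m \<le> real (2 ^ max_exponent_log P g)"
    by (simp add: powr_realpow)
  then have "?m \<le> 2 ^ max_exponent_log P g"
    by (simp only: of_nat_le_iff)
  \<comment> \<open>The maximal exponent may be exactly a power of two, whose top bit needs one
    position more than the logarithm.\<close>
  also have "(2 :: nat) ^ max_exponent_log P g < 2 ^ Suc (max_exponent_log P g)"
    by simp
  finally show ?thesis
    using \<open>k \<le> ?m\<close> by simp
qed

lemma max_exponent_log_le: "max_exponent_log P g \<le> exponent_bits (max_exponent P g)"
  by (simp add: max_exponent_log_def exponent_bits_def)

text \<open>A generator that occurs is paid for by any one of its syllables; one that does not occur
  contributes nothing, as \<open>max_exponent_log\<close> lacks the lower bound \<open>1\<close> of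
  \<open>exponent_bits\<close>.\<close>

lemma sum_max_exponent_log_le:
  "sum (max_exponent_log P) {..<n} \<le> (\<Sum>r\<leftarrow>rels P. word_binary_size P r)"
proof -
  \<comment> \<open>The generators of all syllables with repetition: its set indexes the costs to be
    paid, the list itself the binary size.\<close>
  define gs where "gs = concat (map (\<lambda>r. map (\<lambda>(x, k). fst x) (syllables r)) (rels P))"
  let ?bits = "\<lambda>g. exponent_bits (max_exponent P g)"
  have unused: "max_exponent_log P g = 0" if "g \<notin> set gs" for g
  proof -
    have "{k. \<exists>r\<in>set (rels P). \<exists>b. ((g, b), k) \<in> set (syllables r)} = {}"
      using that by (force simp: gs_def)
    then show ?thesis
      \<comment> \<open>The maximal exponent defaults to \<open>0\<close>, and
        \<open>log 2 0\<close> is \<open>0\<close> by convention.\<close>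
      unfolding max_exponent_log_def max_exponent_def by (simp add: log_def)
  qed
  have "sum (max_exponent_log P) {..<n} = sum (max_exponent_log P) ({..<n} \<inter> set gs)"
    using unused by (intro sum.mono_neutral_right) auto
  also have "\<dots> \<le> sum (max_exponent_log P) (set gs)"
    by (intro sum_mono2) auto
  also have "\<dots> \<le> sum ?bits (set gs)"
    by (intro sum_mono max_exponent_log_le)
  also have "\<dots> \<le> sum_list (map ?bits gs)"
    by (rule sum_set_le_sum_list)
  also have "\<dots> = (\<Sum>r\<leftarrow>rels P. word_binary_size P r)"
  proof -
    have "sum_list (map ?bits (concat (map (\<lambda>r. map (\<lambda>(x, k). fst x) (syllables r)) rs)))
        = (\<Sum>r\<leftarrow>rs. word_binary_size P r)" for rs
      by (induction rs) (simp_all add: word_binary_size_def comp_def case_prod_unfold)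
    then show ?thesis by (simp add: gs_def)
  qed
  finally show ?thesis .
qed

lemma unary_size_compressed_le_binary_size:
  "unary_size (compressed idx (max_exponent_log P) P) \<le> 6 * binary_size P"
proof -
  \<comment> \<open>Here the lower bound \<open>1\<close> in \<open>exponent_bits\<close> pays for
    the additional bit position.\<close>
  have "Suc (max_exponent_log P g) \<le> 2 * exponent_bits (max_exponent P g)" for g
    using max_exponent_log_le[of P g] by (simp add: exponent_bits_def)
  then have "(\<Sum>(x, k)\<leftarrow>syllables r. Suc (max_exponent_log P (fst x))) \<le> 2 * word_binary_size P r" for r
    unfolding word_binary_size_def sum_list_const_mult[symmetric]
    by (intro sum_list_mono) (simp add: case_prod_unfold)
  then have "(\<Sum>r\<leftarrow>rels P. \<Sum>(x, k)\<leftarrow>syllables r. Suc (max_exponent_log P (fst x)))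
      \<le> 2 * (\<Sum>r\<leftarrow>rels P. word_binary_size P r)"
    unfolding sum_list_const_mult[symmetric] by (intro sum_list_mono)
  \<comment> \<open>The constant \<open>6\<close> is \<open>4\<close> for the added powers plus
    \<open>2\<close> for the rewritten relations.\<close>
  moreover have "u \<le> 6 * (n + b)" if "x \<le> 2 * b" "u \<le> n + 4 * s + x" "s \<le> b" for u n s x b :: nat
    using that by simp
  ultimately show ?thesis
    unfolding binary_size_def using unary_size_compressed sum_max_exponent_log_le by blast
qed

theorem theorem2:
  shows "\<exists>C::real. \<forall>P. is_presentation P \<longrightarrow>
           (\<exists>P'. is_presentation P' \<and> equivalent P P' \<and>
                 real (unary_size P') \<le> C * real (binary_size P) * max 1 (log 2 (real (ngens P))))"
proof (intro exI[of _ 6] allI impI)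
  fix P assume P: "is_presentation P"
  let ?c = "max_exponent_log P"
  have "finite (power_index ?c (ngens P))"
    by (simp add: power_index_def)
  then obtain idx where
    idx: "bij_betw idx (power_index ?c (ngens P)) {..<card (power_index ?c (ngens P))}"
    using ex_bij_betw_finite_nat by (metis lessThan_atLeast0)
  have "set (rels P) \<subseteq> words (ngens P)"
    using P by (simp add: is_presentation_def)
  note compressed = equivalent_compressed[OF this idx, OF exponent_less_power]
  have "equivalent P (compressed idx ?c P)"
    by (rule compressed(2))
  moreover have "is_presentation (compressed idx ?c P)"
    using P compressed(1) ngens_le_length_rels_compressed[of P idx ?c] by (simp add: is_presentation_def)
  moreover have "real (unary_size (compressed idx ?c P))
      \<le> 6 * real (binary_size P) * max 1 (log 2 (real (ngens P)))"
  proof -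
    have "real (unary_size (compressed idx ?c P)) \<le> 6 * real (binary_size P) * 1"
      using unary_size_compressed_le_binary_size[of idx P] by linarith
    \<comment> \<open>The logarithmic factor is at least \<open>1\<close>, so it can only enlarge
      the bound.\<close>
    also have "\<dots> \<le> 6 * real (binary_size P) * max 1 (log 2 (real (ngens P)))"
      by (intro mult_left_mono) auto
    finally show ?thesis .
  qed
  ultimately show "\<exists>P'. is_presentation P' \<and> equivalent P P' \<and>
      real (unary_size P') \<le> 6 * real (binary_size P) * max 1 (log 2 (real (ngens P)))"
    by blast
qed

end
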